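(* Let $k$ be an infinite field, $I$ a set of cardinality less than every measurable cardinal $>\mathrm{card}(k)$ (if any exist), $V$ a finite-dimensional $k$-vector space, and $g:k^I\to V$ a $k$-linear map. Then there exist elements $i_1,\dots,i_n\in I$ (for some $n\geq 0$) such that, writing $J_0=I-\{i_1,\dots,i_n\}$, every element of $g(k^{J_0})$ is the image under $g$ of an element having support precisely $J_0$. In particular, applying this to $0\in g(k^{J_0})$, there exists some $u=(u_i)\in\ker(g)$ such that $u_i=0$ for only finitely many $i$ (namely $i_1,\dots,i_n$).
   Context: For $u=(u_i)_{i\in I}\in k^I$, $\mathrm{supp}(u)=\{i\in I\mid u_i\neq 0\}$. For $J\subseteq I$, $k^J$ is identified with the subspace of $k^I$ consisting of the elements whose support is contained in $J$. A measurable cardinal is a cardinal $\mu$ admitting a nonprincipal $\mu$-complete ultrafilter (closed under intersections of fewer than $\mu$ members); by convention $\aleph_0$ is counted as measurable (irrelevant here for cardinals $>\mathrm{card}(k)$, as $k$ is infinite). *)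

theory Defs
  imports "HOL-Analysis.Analysis"
begin

unbundle cardinal_syntax

definition ultrafilter_on :: "'a set \<Rightarrow> 'a set set \<Rightarrow> bool" where
  "ultrafilter_on X U \<longleftrightarrow>
     U \<subseteq> Pow X \<and> X \<in> U \<and> {} \<notin> U \<and>
     (\<forall>A\<in>U. \<forall>B. A \<subseteq> B \<and> B \<subseteq> X \<longrightarrow> B \<in> U) \<and>
     (\<forall>A\<in>U. \<forall>B\<in>U. A \<inter> B \<in> U) \<and>
     (\<forall>A. A \<subseteq> X \<longrightarrow> A \<in> U \<or> X - A \<in> U)"

definition principal_on :: "'a set \<Rightarrow> 'a set set \<Rightarrow> bool" where
  "principal_on X U \<longleftrightarrow> (\<exists>x\<in>X. U = {A. A \<subseteq> X \<and> x \<in> A})"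

definition complete_for :: "'b rel \<Rightarrow> 'a set set \<Rightarrow> bool" where
  "complete_for \<mu> U \<longleftrightarrow> (\<forall>\<A>. \<A> \<subseteq> U \<and> \<A> \<noteq> {} \<and> |\<A>| <o \<mu> \<longrightarrow> \<Inter>\<A> \<in> U)"

text \<open>
  Cardinals are represented, as in the library, by well-orders \<open>\<mu>\<close> with \<^term>\<open>Card_order \<mu>\<close>;
  the underlying set is \<^term>\<open>Field \<mu>\<close>. The definition does not exclude \<open>\<mu> = \<aleph>\<^sub>0\<close>. Finite \<open>\<mu>\<close>
  are excluded automatically, since every ultrafilter on a finite set is principal.
\<close>

definition measurable_cardinal :: "'a rel \<Rightarrow> bool" where
  "measurable_cardinal \<mu> \<longleftrightarrow>
     Card_order \<mu> \<and>
     (\<exists>U. ultrafilter_on (Field \<mu>) U \<and> \<not> principal_on (Field \<mu>) U \<and> complete_for \<mu> U)"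

text \<open>
  A cardinal that cannot be represented on the element type of \<open>I\<close> is automatically larger than
  \<^term>\<open>|I|\<close>. So the quantifier below, although it ranges over the orders on a single type,
  imposes the condition for all measurable cardinals, on whatever type they live; this is the
  content of the lemma \<open>below_measurable_cardinals_aboveD\<close>.
\<close>

definition below_measurable_cardinals_above :: "'k set \<Rightarrow> 'i set \<Rightarrow> bool" where
  "below_measurable_cardinals_above K I \<longleftrightarrow>
     (\<forall>\<mu> :: 'i rel. measurable_cardinal \<mu> \<and> |K| <o \<mu> \<longrightarrow> |I| <o \<mu>)"

lemma measurable_cardinal_dir_image:
  assumes m: "measurable_cardinal \<mu>" and f: "inj_on f (Field \<mu>)"
  shows "measurable_cardinal (dir_image \<mu> f)" "\<mu> =o dir_image \<mu> f"
proof -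
  let ?X = "Field \<mu>" and ?\<nu> = "dir_image \<mu> f"
  obtain U where U: "ultrafilter_on ?X U" "\<not> principal_on ?X U" "complete_for \<mu> U"
    and c: "Card_order \<mu>"
    using m unfolding measurable_cardinal_def by blast
  show iso: "\<mu> =o ?\<nu>"
    using c f by (intro dir_image_ordIso) (simp_all add: card_order_on_well_order_on)
  have c': "Card_order ?\<nu>"
    using Card_order_ordIso2[OF c iso] .
  have F: "Field ?\<nu> = f ` ?X" by (rule dir_image_Field)
  let ?U = "(`) f ` U"
  have sub: "A \<subseteq> ?X" if "A \<in> U" for A using U(1) that unfolding ultrafilter_on_def by blast
  have up: "B \<in> U" if "A \<in> U" "A \<subseteq> B" "B \<subseteq> ?X" for A B
    using U(1) that unfolding ultrafilter_on_def by blast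
  have u1: "ultrafilter_on (f ` ?X) ?U"
    unfolding ultrafilter_on_def
  proof (intro conjI ballI allI impI)
    show "?U \<subseteq> Pow (f ` ?X)" using sub by blast
    show "f ` ?X \<in> ?U" "{} \<notin> ?U" using U(1) unfolding ultrafilter_on_def by auto
  next
    fix A B assume "A \<in> ?U" and B: "A \<subseteq> B \<and> B \<subseteq> f ` ?X"
    then obtain A' where A': "A' \<in> U" "A = f ` A'" by blast
    obtain B' where B': "B' \<subseteq> ?X" "B = f ` B'" using B by (meson subset_imageE)
    have "A' \<subseteq> B'" using A' B' B sub[OF A'(1)] f by (simp add: inj_on_image_subset_iff)
    hence "B' \<in> U" using up[OF A'(1)] B' by simp
    thus "B \<in> ?U" using B' by blast
  next
    fix A B assume "A \<in> ?U" "B \<in> ?U"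
    then obtain A' B' where AB: "A' \<in> U" "A = f ` A'" "B' \<in> U" "B = f ` B'" by blast
    have "f ` (A' \<inter> B') = A \<inter> B" using AB sub f by (simp add: inj_on_image_Int)
    moreover have "A' \<inter> B' \<in> U" using U(1) AB unfolding ultrafilter_on_def by blast
    ultimately show "A \<inter> B \<in> ?U" by blast
  next
    fix A assume "A \<subseteq> f ` ?X"
    then obtain A' where A': "A' \<subseteq> ?X" "A = f ` A'" by (meson subset_imageE)
    have "f ` (?X - A') = f ` ?X - A" using A' f by (simp add: inj_on_image_set_diff)
    moreover have "A' \<in> U \<or> ?X - A' \<in> U" using U(1) A' unfolding ultrafilter_on_def by blast
    ultimately show "A \<in> ?U \<or> f ` ?X - A \<in> ?U"
      using A'(2) imageI[of A' U "(`) f"] imageI[of "?X - A'" U "(`) f"] by simp blast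
  qed
  have u2: "\<not> principal_on (f ` ?X) ?U"
  proof
    assume "principal_on (f ` ?X) ?U"
    then obtain x where x: "x \<in> ?X" "?U = {A. A \<subseteq> f ` ?X \<and> f x \<in> A}"
      unfolding principal_on_def by blast
    have "f ` {x} \<in> ?U" using x by auto
    then obtain A where A: "A \<in> U" "f ` {x} = f ` A" by blast
    have "{x} = A" using inj_on_image_eq_iff[OF f, of "{x}" A] A(2) sub[OF A(1)] x(1) by auto
    hence xU: "{x} \<in> U" using A by simp
    have "U = {A. A \<subseteq> ?X \<and> x \<in> A}"
    proof (intro equalityI subsetI)
      fix A assume "A \<in> U"
      moreover have "A \<inter> {x} \<in> U" using \<open>A \<in> U\<close> xU U(1) unfolding ultrafilter_on_def by blast
      moreover have "{} \<notin> U" using U(1) unfolding ultrafilter_on_def by blast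
      ultimately show "A \<in> {A. A \<subseteq> ?X \<and> x \<in> A}" using sub by (cases "x \<in> A") auto
    next
      fix A assume "A \<in> {A. A \<subseteq> ?X \<and> x \<in> A}"
      hence "{x} \<subseteq> A" "A \<subseteq> ?X" by auto
      thus "A \<in> U" using up[OF xU] by simp
    qed
    thus False using U(2) x(1) unfolding principal_on_def by blast
  qed
  have u3: "complete_for ?\<nu> ?U"
    unfolding complete_for_def
  proof (intro allI impI)
    fix \<A> assume A: "\<A> \<subseteq> ?U \<and> \<A> \<noteq> {} \<and> |\<A>| <o ?\<nu>"
    then obtain \<B> where B: "\<B> \<subseteq> U" "inj_on ((`) f) \<B>" "\<A> = (`) f ` \<B>"
      using subset_image_inj[of \<A> "(`) f" U] by blast
    have "|\<B>| =o |\<A>|" unfolding B(3) using B(2) by (intro card_of_ordIsoI[of "(`) f"] inj_on_imp_bij_betw)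
    hence "|\<B>| <o \<mu>" 
      using A ordIso_ordLess_trans[of "|\<B>|" "|\<A>|" ?\<nu>] ordLess_ordIso_trans ordIso_symmetric[OF iso]
      by blast
    moreover have ne: "\<B> \<noteq> {}" using A B by blast
    ultimately have "\<Inter>\<B> \<in> U" using U(3) B unfolding complete_for_def by blast
    moreover have "f ` (\<Inter>\<B>) = \<Inter>\<A>"
    proof -
      obtain B0 where "B0 \<in> \<B>" using ne by blast
      then have "f ` (\<Inter>B\<in>\<B>. B) = (\<Inter>B\<in>\<B>. f ` B)"
        using image_INT[OF f, of \<B> "\<lambda>B. B"] B sub by blast
      thus ?thesis using B by simp
    qed
    ultimately show "\<Inter>\<A> \<in> ?U" by blast
  qed
  show "measurable_cardinal ?\<nu>"
    using c' u1 u2 u3 unfolding measurable_cardinal_def F[symmetric] by blast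
qed

lemma below_measurable_cardinals_aboveD:
  fixes \<mu> :: "'c rel" and I :: "'i set"
  assumes b: "below_measurable_cardinals_above K I"
    and m: "measurable_cardinal \<mu>" and K: "|K| <o \<mu>"
  shows "|I| <o \<mu>"
proof (rule ccontr)
  assume n: "\<not> |I| <o \<mu>"
  have c: "Card_order \<mu>" using m unfolding measurable_cardinal_def by blast
  hence le: "\<mu> \<le>o |I|"
    using n ordLess_or_ordLeq[OF card_of_Well_order[of I] card_order_on_well_order_on[OF c]] by blast
  hence "|Field \<mu>| \<le>o |I|"
    using card_of_Field_ordIso[OF c] ordIso_ordLeq_trans by blast
  then obtain f where f: "inj_on f (Field \<mu>)" "f ` Field \<mu> \<subseteq> I"
    using card_of_ordLeq[of "Field \<mu>" I] by blast
  note d = measurable_cardinal_dir_image[OF m f(1)]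
  have "|K| <o dir_image \<mu> f" using K d(2) by (rule ordLess_ordIso_trans)
  hence "|I| <o dir_image \<mu> f"
    using b d(1) unfolding below_measurable_cardinals_above_def by blast
  hence "|I| <o \<mu>" using d(2) ordIso_symmetric ordLess_ordIso_trans by blast
  thus False using n by blast
qed

text \<open>
  \<open>power_space J\<close> is \<open>k\<^sup>J\<close>, as a set of functions on the whole index type that vanish outside \<open>J\<close>.
  With this encoding \<open>k\<^sup>J\<close> is literally the subspace of \<open>k\<^sup>I\<close> of elements with support in \<open>J\<close>.
\<close>

definition power_space :: "'i set \<Rightarrow> ('i \<Rightarrow> 'k::zero) set" where
  "power_space J = {u. \<forall>i. i \<notin> J \<longrightarrow> u i = 0}"

lemma power_space_eq_support:
  assumes "J \<subseteq> I"
  shows "power_space J = {u \<in> power_space I. support_on I u \<subseteq> J}"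
  using assms by (auto simp: power_space_def support_on_def)

definition linear_on_power ::
  "('k::field \<Rightarrow> 'v::ab_group_add \<Rightarrow> 'v) \<Rightarrow> 'i set \<Rightarrow> (('i \<Rightarrow> 'k) \<Rightarrow> 'v) \<Rightarrow> bool" where
  "linear_on_power scl I g \<longleftrightarrow>
     (\<forall>u\<in>power_space I. \<forall>w\<in>power_space I. g (\<lambda>i. u i + w i) = g u + g w) \<and>
     (\<forall>c. \<forall>u\<in>power_space I. g (\<lambda>i. c * u i) = scl c (g u))"

end

theory Submission
  imports Defs "HOL-Computational_Algebra.Polynomial"
begin

text \<open>
  For a subspace \<open>W\<close> of \<open>V\<close>, call \<open>J\<close> good if modulo \<open>W\<close> every element of \<open>g(k\<^sup>J)\<close> is the image of
  an element with support exactly \<open>J\<close>, and null if \<open>g(k\<^sup>J) \<subseteq> W\<close>. By induction on the codimension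
  of \<open>W\<close>, every \<open>A \<subseteq> I\<close> becomes good after removing finitely many points. A counterexample \<open>A\<close>
  cannot be an atom of the Boolean algebra of sets modulo null sets: on an atom the non-null sets
  form an ultrafilter; if it is principal, remove its point; otherwise, below the measurable
  cardinals, some \<open>f : A \<rightarrow> k\<close> has only null fibres, a linear dependence among the images of
  \<open>1, f, f\<^sup>2, \<dots>\<close> gives a nonzero polynomial \<open>p\<close> with \<open>g(p(f)) \<in> W\<close>, and \<open>p(f)\<close> vanishes only on
  a null set. So \<open>A\<close> can be split again and again, and contains infinitely many disjoint non-null
  sets. Grouping these with minimal dimension of the image gives infinitely many disjoint blocks
  with the same image \<open>W'\<close> modulo \<open>W\<close>, where \<open>W'\<close> properly contains \<open>W\<close>. Elements with support
  equal to the union of finitely many blocks already reach all of \<open>W'\<close> modulo \<open>W\<close>, and the rest of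
  \<open>A\<close> is handled by the induction hypothesis for \<open>W'\<close>.
\<close>

section \<open>Linear algebra modulo a subspace\<close>

context finite_dimensional_vector_space
begin

lemma span_Un_image_coeffs:
  assumes "finite M" "subspace W" "v \<in> span (W \<union> f ` M)"
  shows "\<exists>c. v - (\<Sum>j\<in>M. scale (c j) (f j)) \<in> W"
  using assms(1,3)
proof (induction M arbitrary: v rule: finite_induct)
  case empty
  then show ?case using assms(2) by (simp add: span_eq_iff[THEN iffD2])
next
  case (insert j M)
  have "v \<in> span (insert (f j) (W \<union> f ` M))" using insert.prems by simp
  then obtain a where "v - scale a (f j) \<in> span (W \<union> f ` M)"
    using span_breakdown_eq by blast
  then obtain c where c: "v - scale a (f j) - (\<Sum>i\<in>M. scale (c i) (f i)) \<in> W"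
    using insert.IH by blast
  have "(\<Sum>i\<in>M. scale ((c(j := a)) i) (f i)) = (\<Sum>i\<in>M. scale (c i) (f i))"
    using insert.hyps by (intro sum.cong) auto
  then have "v - (\<Sum>i\<in>insert j M. scale ((c(j := a)) i) (f i)) \<in> W"
    using c insert.hyps by (simp add: algebra_simps)
  then show ?case by blast
qed

text \<open>Redundancy of \<open>f j\<close> gives a relation modulo \<open>W\<close> whose
  coefficient at \<open>j\<close> is 1. Adding a suitable multiple of it makes the coefficient at
  \<open>j\<close> nonzero without destroying those already nonzero, since an infinite field leaves
  room to avoid finitely many bad multiples. The set \<open>Q\<close> of indices treated grows one
  at a time.\<close>

lemma nonzero_coeffs:
  assumes inf: "infinite (UNIV :: 'a set)" and M: "finite M" and W: "subspace W"
    and v: "v \<in> span (W \<union> f ` M)"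
    and red: "\<And>j. j \<in> M \<Longrightarrow> f j \<in> span (W \<union> f ` (M - {j}))"
  shows "\<exists>c. (\<forall>j\<in>M. c j \<noteq> 0) \<and> v - (\<Sum>j\<in>M. scale (c j) (f j)) \<in> W"
proof -
  have "\<exists>c. (\<forall>j\<in>Q. c j \<noteq> 0) \<and> v - (\<Sum>j\<in>M. scale (c j) (f j)) \<in> W" if "Q \<subseteq> M" for Q
    using finite_subset[OF that M] that
  proof (induction Q rule: finite_induct)
    case empty
    then show ?case using span_Un_image_coeffs[OF M W v] by simp
  next
    case (insert j Q)
    then obtain c where c: "\<forall>i\<in>Q. c i \<noteq> 0" "v - (\<Sum>i\<in>M. scale (c i) (f i)) \<in> W" by blast
    have j: "j \<in> M" using insert.prems by blast
    obtain a where a: "f j - (\<Sum>i\<in>M - {j}. scale (a i) (f i)) \<in> W"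
      using span_Un_image_coeffs[OF _ W red[OF j]] M by blast
    define r where "r = (\<lambda>i. if i = j then 1 else - a i)"
    have "(\<Sum>i\<in>M. scale (r i) (f i)) = f j + (\<Sum>i\<in>M - {j}. scale (r i) (f i))"
      by (subst sum.remove[OF M j]) (simp add: r_def)
    also have "(\<Sum>i\<in>M - {j}. scale (r i) (f i)) = - (\<Sum>i\<in>M - {j}. scale (a i) (f i))"
      unfolding sum_negf[symmetric] by (intro sum.cong) (auto simp: r_def)
    finally have r: "(\<Sum>i\<in>M. scale (r i) (f i)) \<in> W" using a by simp
    \<comment> \<open>If \<open>r i \<noteq> 0\<close>, the only bad multiple for \<open>i\<close>
      is \<open>- c i / r i\<close>. If \<open>r i = 0\<close>, the quotient is 0 by convention, so
      only \<open>l = 0\<close> is excluded for it; the coefficient at \<open>i\<close> then stays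
      \<open>c i\<close>, which is nonzero because \<open>i \<noteq> j\<close>.\<close>
    obtain l where l: "l \<notin> (\<lambda>i. - c i / r i) ` insert j Q"
      using ex_new_if_finite[OF inf, of "(\<lambda>i. - c i / r i) ` insert j Q"] insert.hyps by blast
    have nz: "c i + l * r i \<noteq> 0" if i: "i \<in> insert j Q" for i
    proof (cases "r i = 0")
      case True
      then have "i \<noteq> j" by (auto simp: r_def)
      then show ?thesis using True i c by auto
    next
      case False
      have "l \<noteq> - c i / r i" using l i by blast
      then have "l * r i \<noteq> - c i" using False by (metis nonzero_eq_divide_eq)
      then show ?thesis by (metis add.commute eq_neg_iff_add_eq_0)
    qed
    have "(\<Sum>i\<in>M. scale (c i + l * r i) (f i))
        = (\<Sum>i\<in>M. scale (c i) (f i)) + scale l (\<Sum>i\<in>M. scale (r i) (f i))"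
      by (simp add: scale_left_distrib sum.distrib scale_sum_right)
    then have "v - (\<Sum>i\<in>M. scale (c i + l * r i) (f i))
        = (v - (\<Sum>i\<in>M. scale (c i) (f i))) - scale l (\<Sum>i\<in>M. scale (r i) (f i))"
      by simp
    also have "\<dots> \<in> W" by (rule subspace_diff[OF W c(2) subspace_scale[OF W r]])
    finally show ?case using nz by (intro exI[of _ "\<lambda>i. c i + l * r i"]) simp
  qed
  then show ?thesis by blast
qed

lemma spanning_selection:
  fixes F :: "nat \<Rightarrow> 'b set"
  assumes "\<And>n. W' \<subseteq> span (W \<union> F n)" "finite E"
  shows "\<exists>M f. finite M \<and> M \<inter> E = {} \<and> (\<forall>j\<in>M. f j \<in> F j) \<and> W' \<subseteq> span (W \<union> f ` M)"
  using assms
proof (induction "dim (UNIV :: 'b set) - dim W" arbitrary: W E rule: less_induct)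
  case less
  show ?case
  proof (cases "W' \<subseteq> span W")
    case True
    then show ?thesis by (intro exI[of _ "{}"]) auto
  next
    case False
    obtain n where n: "n \<notin> E" using ex_new_if_finite[OF infinite_UNIV_nat less.prems(2)] by blast
    have "\<not> F n \<subseteq> span W"
    proof
      assume "F n \<subseteq> span W"
      then have "span (W \<union> F n) \<subseteq> span W" by (intro span_minimal) (auto intro: span_base)
      then show False using False less.prems(1)[of n] by blast
    qed
    then obtain x where x: "x \<in> F n" "x \<notin> span W" by blast
    have d: "dim (insert x W) = Suc (dim W)" using x by (simp add: dim_insert)
    have "dim (insert x W) \<le> dim (UNIV :: 'b set)" by (rule dim_subset) simp
    then have lt: "dim (UNIV :: 'b set) - dim (insert x W) < dim (UNIV :: 'b set) - dim W"
      using d by simp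
    have "W' \<subseteq> span (insert x W \<union> F m)" for m
      using less.prems(1)[of m] span_mono[of "W \<union> F m" "insert x W \<union> F m"] by blast
    then obtain M f where M: "finite M" "M \<inter> insert n E = {}" "\<forall>j\<in>M. f j \<in> F j"
      "W' \<subseteq> span (insert x W \<union> f ` M)"
      \<comment> \<open>Forbidding \<open>n\<close> as well keeps this index free for
        \<open>x\<close>.\<close>
      using less.hyps[OF lt, of "insert n E"] less.prems(2) by blast
    have "(f(n := x)) ` insert n M = insert x (f ` M)" using M(2) by (auto simp: image_iff)
    then show ?thesis using M x n
      by (intro exI[of _ "insert n M"] exI[of _ "f(n := x)"]) auto
  qed
qed

lemma ex_in_span_predecessors:
  fixes h :: "nat \<Rightarrow> 'b"
  shows "\<exists>n. h n \<in> span (W \<union> h ` {..<n})"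
proof (rule ccontr)
  assume n: "\<nexists>n. h n \<in> span (W \<union> h ` {..<n})"
  have "n \<le> dim (W \<union> h ` {..<n})" for n
  proof (induction n)
    case (Suc n)
    have "W \<union> h ` {..<Suc n} = insert (h n) (W \<union> h ` {..<n})" by (auto simp: lessThan_Suc)
    then show ?case using n Suc by (simp add: dim_insert)
  qed simp
  from this[of "Suc (dim (UNIV :: 'b set))"] show False
    using dim_subset[of "W \<union> h ` {..<Suc (dim (UNIV :: 'b set))}" UNIV] by simp
qed

end

section \<open>Ultrafilters below the measurable cardinals\<close>

text \<open>Among the sets \<open>Y\<close> that receive a map from \<open>A\<close> with all fibres
  outside \<open>U\<close>, take one of least cardinality. If it embeds in the field, the composite
  map is as wanted. Otherwise the image of \<open>U\<close> on \<open>Y\<close> is a nonprincipal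
  \<open>|Y|\<close>-complete ultrafilter, so \<open>|Y|\<close> is a measurable cardinal above that
  of the field and at most \<open>|I|\<close>, a contradiction.\<close>

lemma ex_fibres_not_in_ultrafilter:
  fixes A I :: "'i set"
  assumes below: "below_measurable_cardinals_above (UNIV :: 'k set) I"
    and A: "A \<subseteq> I" and U: "ultrafilter_on A U" and np: "\<not> principal_on A U"
  shows "\<exists>f :: 'i \<Rightarrow> 'k. \<forall>c. {i \<in> A. f i = c} \<notin> U"
proof -
  have up: "C \<in> U" if "B \<in> U" "B \<subseteq> C" "C \<subseteq> A" for B C
    using U that unfolding ultrafilter_on_def by blast
  have int: "B \<inter> C \<in> U" if "B \<in> U" "C \<in> U" for B C
    using U that unfolding ultrafilter_on_def by blast
  have sub: "B \<subseteq> A" if "B \<in> U" for B using U that unfolding ultrafilter_on_def by blast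
  have compl: "A - B \<in> U" if "B \<subseteq> A" "B \<notin> U" for B
    using U that unfolding ultrafilter_on_def by blast
  have emp: "{} \<notin> U" and AU: "A \<in> U" using U unfolding ultrafilter_on_def by auto
  have nboth: "\<not> (B \<in> U \<and> A - B \<in> U)" for B using int[of B "A - B"] emp by auto
  \<comment> \<open>Targets are restricted to subsets of \<open>A\<close> so that \<open>|Y|\<close>
    is at most \<open>|I|\<close>. The identity shows that \<open>A\<close> itself qualifies,
    because \<open>U\<close> is nonprincipal.\<close>
  define bad where "bad Y \<longleftrightarrow> Y \<subseteq> A \<and> (\<exists>f. f ` A \<subseteq> Y \<and> (\<forall>y. {i \<in> A. f i = y} \<notin> U))" for Y :: "'i set"
  have "{i \<in> A. i = y} \<notin> U" for y
  proof
    assume y: "{i \<in> A. i = y} \<in> U"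
    then have yA: "y \<in> A" using emp by (metis (mono_tags, lifting) empty_Collect_eq)
    then have yU: "{y} \<in> U" using y by (metis (mono_tags, lifting) Collect_cong singleton_conv)
    have "U = {B. B \<subseteq> A \<and> y \<in> B}"
    proof (intro equalityI subsetI)
      fix B assume B: "B \<in> U"
      then have "B \<inter> {y} \<noteq> {}" using int[OF B yU] emp by metis
      then show "B \<in> {B. B \<subseteq> A \<and> y \<in> B}" using sub[OF B] by auto
    qed (use up[OF yU] in auto)
    then show False using np yA unfolding principal_on_def by blast
  qed
  then have "bad A" unfolding bad_def by (intro conjI exI[of _ id]) auto
  then obtain Y where Y: "bad Y" and min: "\<And>Z. bad Z \<Longrightarrow> |Y| \<le>o |Z|"
    using exists_minim_Card_order[of "card_of ` Collect bad"] card_of_Card_order by fastforce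
  obtain f where f: "f ` A \<subseteq> Y" "\<And>y. {i \<in> A. f i = y} \<notin> U" and YA: "Y \<subseteq> A"
    using Y unfolding bad_def by blast
  show ?thesis
  proof (cases "|Y| \<le>o |UNIV :: 'k set|")
    case True
    then obtain e :: "'i \<Rightarrow> 'k" where e: "inj_on e Y" using iffD2[OF card_of_ordLeq True] by blast
    have "{i \<in> A. e (f i) = c} \<notin> U" for c
    proof
      assume c: "{i \<in> A. e (f i) = c} \<in> U"
      then obtain i where i: "i \<in> A" "e (f i) = c" using emp by (metis (mono_tags, lifting) empty_Collect_eq)
      have "{i \<in> A. e (f i) = c} \<subseteq> {j \<in> A. f j = f i}"
        using i f(1) e by (auto simp: inj_on_def image_subset_iff)
      then show False using up[OF c] f(2) by blast
    qed
    then show ?thesis by (intro exI[of _ "e \<circ> f"]) simp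
  next
    case False
    then have lt: "|UNIV :: 'k set| <o |Y|" 
      using ordLess_or_ordLeq[OF card_of_Well_order card_of_Well_order] by blast
    \<comment> \<open>The pushforward of \<open>U\<close> along \<open>f\<close>.\<close>
    define V where "V = {Z. Z \<subseteq> Y \<and> {i \<in> A. f i \<in> Z} \<in> U}"
    have "ultrafilter_on Y V"
      unfolding ultrafilter_on_def
    proof (intro conjI ballI allI impI)
      have "{i \<in> A. f i \<in> Y} = A" using f(1) by blast
      then show "Y \<in> V" using AU by (simp add: V_def)
      show "{} \<notin> V" using emp by (simp add: V_def)
    next
      fix B C assume "B \<in> V" "B \<subseteq> C \<and> C \<subseteq> Y"
      then show "C \<in> V" using up[of "{i \<in> A. f i \<in> B}" "{i \<in> A. f i \<in> C}"] by (auto simp: V_def)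
    next
      fix B C assume BC: "B \<in> V" "C \<in> V"
      have "{i \<in> A. f i \<in> B \<inter> C} = {i \<in> A. f i \<in> B} \<inter> {i \<in> A. f i \<in> C}" by blast
      then show "B \<inter> C \<in> V" using BC int by (auto simp: V_def)
    next
      fix B assume B: "B \<subseteq> Y"
      have "{i \<in> A. f i \<in> Y - B} = A - {i \<in> A. f i \<in> B}" using f(1) by blast
      then show "B \<in> V \<or> Y - B \<in> V" using B compl[of "{i \<in> A. f i \<in> B}"] by (auto simp: V_def)
    qed (auto simp: V_def)
    moreover have "\<not> principal_on Y V"
    proof
      assume "principal_on Y V"
      then obtain y where "y \<in> Y" "V = {Z. Z \<subseteq> Y \<and> y \<in> Z}" unfolding principal_on_def by blast
      then have "{y} \<in> V" by blast
      then show False using f(2)[of y] by (simp add: V_def)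
    qed
    moreover have "complete_for |Y| V"
      unfolding complete_for_def
    proof (intro allI impI, rule ccontr)
      fix \<A> assume \<A>: "\<A> \<subseteq> V \<and> \<A> \<noteq> {} \<and> |\<A>| <o |Y|" and nV: "\<Inter>\<A> \<notin> V"
      obtain Z0 where Z0: "Z0 \<in> \<A>" using \<A> by blast
      have all: "{i \<in> A. f i \<in> \<Inter>\<A>} \<notin> U" using nV Z0 \<A> by (auto simp: V_def)
      have one: "A - {i \<in> A. f i \<in> Z} \<notin> U" if "Z \<in> \<A>" for Z
        using nboth[of "{i \<in> A. f i \<in> Z}"] \<A> that by (auto simp: V_def)
      \<comment> \<open>The family has fewer than \<open>|Y|\<close> members; copying it into
        \<open>Y\<close> turns it into an admissible target that is too small.\<close>
      obtain e where e: "inj_on e \<A>" "e ` \<A> \<subseteq> Y"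
        using iffD2[OF card_of_ordLeq, of \<A> Y] \<A> ordLess_imp_ordLeq by blast
      \<comment> \<open>Each \<open>i\<close> is sent to a member of the family that misses
        \<open>f i\<close>. Where there is none, \<open>f i\<close> lies in the intersection; the
        set of such \<open>i\<close> in \<open>A\<close> is outside \<open>U\<close>, so the default
        \<open>Z0\<close> is harmless. Elsewhere the fibre of \<open>h\<close> over \<open>Z\<close>
        avoids the preimage of \<open>Z\<close>, which is in \<open>U\<close>; hence no fibre is in
        \<open>U\<close>.\<close>
      define h where "h i = (if f i \<in> \<Inter>\<A> then Z0 else (SOME Z. Z \<in> \<A> \<and> f i \<notin> Z))" for i
      have h: "h i \<in> \<A>" "f i \<notin> \<Inter>\<A> \<Longrightarrow> f i \<notin> h i" for i
        using Z0 someI_ex[of "\<lambda>Z. Z \<in> \<A> \<and> f i \<notin> Z"] by (auto simp: h_def)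
      have "{i \<in> A. e (h i) = y} \<notin> U" for y
      proof
        assume y: "{i \<in> A. e (h i) = y} \<in> U"
        then obtain k where k: "k \<in> A" "e (h k) = y"
          using emp by (metis (mono_tags, lifting) empty_Collect_eq)
        have B1: "A - {i \<in> A. f i \<in> \<Inter>\<A>} \<in> U" by (rule compl[OF _ all]) blast
        have B2: "{i \<in> A. f i \<in> h k} \<in> U" using \<A> h(1)[of k] by (auto simp: V_def)
        have "h i = h k" if "e (h i) = y" for i
          using inj_onD[OF e(1), of "h i" "h k"] h(1) k that by simp
        then have "{i \<in> A. e (h i) = y} \<inter> ((A - {i \<in> A. f i \<in> \<Inter>\<A>}) \<inter> {i \<in> A. f i \<in> h k}) = {}"
          using h(2) by fastforce
        then show False using int[OF y int[OF B1 B2]] emp by simp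
      qed
      then have "bad (e ` \<A>)"
        unfolding bad_def using e(2) YA h(1) by (intro conjI exI[of _ "e \<circ> h"]) auto
      then have "|Y| \<le>o |e ` \<A>|" by (rule min)
      also have "|e ` \<A>| \<le>o |\<A>|" by (rule card_of_image)
      finally show False using \<A> not_ordLeq_ordLess by blast
    qed
    ultimately have "measurable_cardinal |Y|"
      unfolding measurable_cardinal_def using card_of_card_order_on[of Y] by (auto simp: Field_card_of)
    then have "|I| <o |Y|" using below_measurable_cardinals_aboveD[OF below _ lt] by blast
    moreover have "|Y| \<le>o |I|" using YA A by (intro card_of_mono1) blast
    ultimately show ?thesis using not_ordLeq_ordLess by blast
  qed
qed

section \<open>Null sets and good sets of a linear map on a power\<close>

locale linear_power_map = finite_dimensional_vector_space scl Basis
  for scl :: "'k::field \<Rightarrow> 'v::ab_group_add \<Rightarrow> 'v" and Basis +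
  fixes I :: "'i set" and g :: "('i \<Rightarrow> 'k) \<Rightarrow> 'v"
  assumes infinite_field: "infinite (UNIV :: 'k set)"
    and linear_g: "linear_on_power scl I g"
begin

definition full :: "'i set \<Rightarrow> ('i \<Rightarrow> 'k) set" where
  "full J = {u. \<forall>i. u i \<noteq> 0 \<longleftrightarrow> i \<in> J}"

definition null :: "'v set \<Rightarrow> 'i set \<Rightarrow> bool" where
  "null W A \<longleftrightarrow> g ` power_space A \<subseteq> W"

definition good :: "'v set \<Rightarrow> 'i set \<Rightarrow> bool" where
  "good W J \<longleftrightarrow> (\<forall>u\<in>power_space J. \<exists>u'\<in>full J. g u' - g u \<in> W)"

definition cofinitely_good :: "'v set \<Rightarrow> 'i set \<Rightarrow> bool" where
  "cofinitely_good W A \<longleftrightarrow> (\<exists>S. finite S \<and> S \<subseteq> A \<and> good W (A - S))"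

lemma full_subset: "full J \<subseteq> power_space J"
  by (auto simp: full_def power_space_def)

lemma power_space_mono: "A \<subseteq> B \<Longrightarrow> power_space A \<subseteq> power_space B"
  by (auto simp: power_space_def)

lemma g_add:
  "u \<in> power_space I \<Longrightarrow> w \<in> power_space I \<Longrightarrow> g (\<lambda>i. u i + w i) = g u + g w"
  using linear_g by (simp add: linear_on_power_def)

lemma g_scale: "u \<in> power_space I \<Longrightarrow> g (\<lambda>i. c * u i) = scl c (g u)"
  using linear_g by (simp add: linear_on_power_def)

lemma g_zero: "g (\<lambda>i. 0) = 0"
  using g_scale[of "\<lambda>i. 0" 0] by (simp add: power_space_def)

lemma g_sum:
  assumes "finite M" "\<And>j. j \<in> M \<Longrightarrow> t j \<in> power_space I"
  shows "g (\<lambda>i. \<Sum>j\<in>M. c j * t j i) = (\<Sum>j\<in>M. scl (c j) (g (t j)))"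
  using assms
proof (induction M rule: finite_induct)
  case empty
  then show ?case by (simp add: g_zero)
next
  case (insert j M)
  have 1: "(\<lambda>i. c j * t j i) \<in> power_space I" using insert.prems[of j] by (simp add: power_space_def)
  have 2: "(\<lambda>i. \<Sum>j\<in>M. c j * t j i) \<in> power_space I"
    using insert.prems by (auto simp: power_space_def intro!: sum.neutral)
  show ?case using insert g_add[OF 1 2] g_scale[of "t j" "c j"] by simp
qed

lemma g_split:
  assumes "u \<in> power_space I"
  shows "g u = g (\<lambda>i. if i \<in> A then u i else 0) + g (\<lambda>i. if i \<in> A then 0 else u i)"
proof -
  have "g (\<lambda>i. (if i \<in> A then u i else 0) + (if i \<in> A then 0 else u i))
      = g (\<lambda>i. if i \<in> A then u i else 0) + g (\<lambda>i. if i \<in> A then 0 else u i)"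
    by (rule g_add) (use assms in \<open>auto simp: power_space_def\<close>)
  moreover have "(\<lambda>i. (if i \<in> A then u i else 0) + (if i \<in> A then 0 else u i)) = u" by auto
  ultimately show ?thesis by simp
qed

text \<open>This allows coordinates in a null set to be changed at will, for instance to repair a
  support: the difference of the images comes from the parts supported in \<open>N\<close>
  alone.\<close>

lemma g_cong_mod_null:
  assumes W: "subspace W" and N: "null W N"
    and u: "u \<in> power_space I" and w: "w \<in> power_space I" and eq: "\<And>i. i \<notin> N \<Longrightarrow> u i = w i"
  shows "g u - g w \<in> W"
proof -
  have "(\<lambda>i. if i \<in> N then 0 else u i) = (\<lambda>i. if i \<in> N then 0 else w i)" using eq by auto
  then have "g u - g w = g (\<lambda>i. if i \<in> N then u i else 0) - g (\<lambda>i. if i \<in> N then w i else 0)"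
    using g_split[OF u, of N] g_split[OF w, of N] by simp
  also have "\<dots> \<in> W"
    using N by (intro subspace_diff[OF W]) (auto simp: null_def power_space_def image_subset_iff)
  finally show ?thesis .
qed

lemma null_mono: "null W B \<Longrightarrow> A \<subseteq> B \<Longrightarrow> null W A"
  unfolding null_def using power_space_mono by blast

lemma null_Un:
  assumes W: "subspace W" and A: "null W A" and B: "null W B" and I: "A \<union> B \<subseteq> I"
  shows "null W (A \<union> B)"
  unfolding null_def
proof (rule image_subsetI)
  fix u :: "'i \<Rightarrow> 'k" assume u: "u \<in> power_space (A \<union> B)"
  have "g (\<lambda>i. if i \<in> A then u i else 0) \<in> W" "g (\<lambda>i. if i \<in> A then 0 else u i) \<in> W"
    using A B u by (auto simp: null_def power_space_def image_subset_iff)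
  then show "g u \<in> W" 
    using g_split[of u A] u power_space_mono[OF I] subspace_add[OF W] by auto
qed

lemma null_UN:
  assumes W: "subspace W" and "finite X" "\<And>x. x \<in> X \<Longrightarrow> null W (A x)" "(\<Union>x\<in>X. A x) \<subseteq> I"
  shows "null W (\<Union>x\<in>X. A x)"
  using assms(2-4)
proof (induction X rule: finite_induct)
  case empty
  have "u = (\<lambda>i. 0)" if "u \<in> power_space {}" for u :: "'i \<Rightarrow> 'k"
    using that by (auto simp: power_space_def)
  then show ?case using subspace_0[OF W] g_zero by (auto simp: null_def)
next
  case (insert x X)
  then show ?case using null_Un[OF W, of "A x" "\<Union>x\<in>X. A x"] by auto
qed

lemma good_null:
  assumes W: "subspace W" and N: "null W A" and A: "A \<subseteq> I"
  shows "good W A"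
  unfolding good_def
proof
  fix u :: "'i \<Rightarrow> 'k" assume u: "u \<in> power_space A"
  let ?u = "\<lambda>i. if i \<in> A then 1 else 0 :: 'k"
  have f: "?u \<in> full A" by (simp add: full_def)
  have "g ?u - g u \<in> W"
    by (rule g_cong_mod_null[OF W N])
      (use u A in \<open>auto simp: power_space_def\<close>)
  then show "\<exists>u'\<in>full A. g u' - g u \<in> W" using f by blast
qed

lemma full_Un:
  assumes "u \<in> full A" "w \<in> full B" "A \<inter> B = {}"
  shows "(\<lambda>i. u i + w i) \<in> full (A \<union> B)"
  using assms by (fastforce simp: full_def)

lemma good_Un:
  assumes W: "subspace W" and A: "good W A" and B: "good W B"
    and disj: "A \<inter> B = {}" and I: "A \<union> B \<subseteq> I"
  shows "good W (A \<union> B)"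
  unfolding good_def
proof
  fix u :: "'i \<Rightarrow> 'k" assume u: "u \<in> power_space (A \<union> B)"
  let ?a = "\<lambda>i. if i \<in> A then u i else 0" and ?b = "\<lambda>i. if i \<in> A then 0 else u i"
  have "?a \<in> power_space A" "?b \<in> power_space B" using u by (auto simp: power_space_def)
  then obtain a b where a: "a \<in> full A" "g a - g ?a \<in> W" and b: "b \<in> full B" "g b - g ?b \<in> W"
    using A B unfolding good_def by blast
  have "a \<in> power_space I" "b \<in> power_space I" "u \<in> power_space I"
    using a b u full_subset power_space_mono I by (auto simp: power_space_def full_def)
  then have "g (\<lambda>i. a i + b i) - g u = (g a - g ?a) + (g b - g ?b)"
    using g_add[of a b] g_split[of u A] by simp
  then have "g (\<lambda>i. a i + b i) - g u \<in> W" using a b subspace_add[OF W] by metis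
  then show "\<exists>u'\<in>full (A \<union> B). g u' - g u \<in> W" using full_Un[OF a(1) b(1) disj] by blast
qed

lemma cofinitely_good_Un:
  assumes "subspace W" "cofinitely_good W A" "cofinitely_good W B" "A \<inter> B = {}" "A \<union> B \<subseteq> I"
  shows "cofinitely_good W (A \<union> B)"
proof -
  obtain S T where S: "finite S" "S \<subseteq> A" "good W (A - S)" and T: "finite T" "T \<subseteq> B" "good W (B - T)"
    using assms unfolding cofinitely_good_def by blast
  have "A \<union> B - (S \<union> T) = (A - S) \<union> (B - T)" using S T assms(4) by blast
  moreover have "good W ((A - S) \<union> (B - T))" using good_Un[OF assms(1) S(3) T(3)] assms(4,5) by blast
  ultimately show ?thesis unfolding cofinitely_good_def
    using S T by (intro exI[of _ "S \<union> T"]) auto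
qed

text \<open>Every \<open>u\<close> is a sum of two vectors with full support: at each index choose
  \<open>p i\<close> different from both 0 and \<open>u i\<close>, and take \<open>u - p\<close> as
  the other summand.\<close>

lemma image_subset_span_full:
  assumes "A \<subseteq> I"
  shows "g ` power_space A \<subseteq> span (g ` full A)"
proof (rule image_subsetI)
  fix u :: "'i \<Rightarrow> 'k" assume u: "u \<in> power_space A"
  have "\<exists>x. x \<noteq> 0 \<and> x \<noteq> u i" for i
    using ex_new_if_finite[OF infinite_field, of "{0, u i}"] by auto
  then obtain p where p: "\<And>i. p i \<noteq> 0 \<and> p i \<noteq> u i" by metis
  let ?p = "\<lambda>i. if i \<in> A then p i else 0" and ?q = "\<lambda>i. if i \<in> A then u i - p i else 0"
  have f: "?p \<in> full A" "?q \<in> full A" using p by (simp_all add: full_def) (metis right_minus_eq)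
  then have "?p \<in> power_space I" "?q \<in> power_space I"
    using full_subset power_space_mono[OF assms] by blast+
  moreover have "(\<lambda>i. ?p i + ?q i) = u" using u by (auto simp: power_space_def)
  ultimately have "g u = g ?p + g ?q" using g_add[of ?p ?q] by simp
  then show "g u \<in> span (g ` full A)" using f by (simp add: span_add span_base)
qed

section \<open>Atoms modulo null sets\<close>

lemma cofinitely_good_atom:
  assumes W: "subspace W" and A: "A \<subseteq> I" and nn: "\<not> null W A"
    and atom: "\<And>B. B \<subseteq> A \<Longrightarrow> null W B \<or> null W (A - B)"
    and below: "below_measurable_cardinals_above (UNIV :: 'k set) I"
  shows "cofinitely_good W A"
proof -
  define U where "U = {B. B \<subseteq> A \<and> \<not> null W B}"
  \<comment> \<open>On an atom, non-null sets are those with null complement; closure of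
    \<open>U\<close> under intersection thus becomes closure of null sets under union.\<close>
  have U_iff: "B \<in> U \<longleftrightarrow> null W (A - B)" if "B \<subseteq> A" for B
    using that atom[OF that] null_Un[OF W, of B "A - B"] nn A
    by (auto simp: U_def Un_absorb1 Un_Diff_cancel)
  have "ultrafilter_on A U"
    unfolding ultrafilter_on_def
  proof (intro conjI ballI allI impI)
    show "{} \<notin> U" using U_iff[of "{}"] nn by simp
  next
    fix B C assume "B \<in> U" "C \<in> U"
    moreover have "A - B \<inter> C = (A - B) \<union> (A - C)" by blast
    ultimately show "B \<inter> C \<in> U"
      using U_iff[of B] U_iff[of C] U_iff[of "B \<inter> C"] null_Un[OF W, of "A - B" "A - C"] A
      by (auto simp: U_def)
  next
    fix B assume "B \<subseteq> A"
    then show "B \<in> U \<or> A - B \<in> U" using U_iff[of B] by (auto simp: U_def)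
  qed (auto simp: U_def nn intro: null_mono)
  show ?thesis
  proof (cases "principal_on A U")
    case True
    then obtain x where x: "x \<in> A" "U = {B. B \<subseteq> A \<and> x \<in> B}" unfolding principal_on_def by blast
    then have "null W (A - {x})" using U_iff[of "{x}"] by simp
    then have "good W (A - {x})" using good_null[OF W] A by blast
    then show ?thesis unfolding cofinitely_good_def using x by (intro exI[of _ "{x}"]) auto
  next
    case False
    then obtain f :: "'i \<Rightarrow> 'k" where f: "\<And>c. {i \<in> A. f i = c} \<notin> U"
      using ex_fibres_not_in_ultrafilter[OF below A \<open>ultrafilter_on A U\<close>] by blast
    have fibre: "null W {i \<in> A. f i = c}" for c using f[of c] by (simp add: U_def)
    \<comment> \<open>The powers of \<open>f\<close>, extended by zero outside \<open>A\<close>. A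
      dependence among their images modulo \<open>W\<close> supplies the coefficients of the monic
      polynomial \<open>p\<close> below.\<close>
    define t where "t n = (\<lambda>i. if i \<in> A then f i ^ n else 0)" for n
    have t: "t n \<in> power_space I" for n using A by (auto simp: t_def power_space_def)
    obtain n where "g (t n) \<in> span (W \<union> (\<lambda>n. g (t n)) ` {..<n})"
      using ex_in_span_predecessors[of "\<lambda>n. g (t n)" W] by blast
    then obtain c where c: "g (t n) - (\<Sum>j<n. scl (c j) (g (t j))) \<in> W"
      using span_Un_image_coeffs[OF _ W] by blast
    define p where "p = monom 1 n - (\<Sum>j<n. monom (c j) j)"
    have "coeff p n = 1" by (simp add: p_def coeff_sum)
    then have "p \<noteq> 0" by auto
    then have fin: "finite {x. poly p x = 0}" by (rule poly_roots_finite)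
    define x where "x = (\<lambda>i. if i \<in> A then poly p (f i) else 0)"
    have "x = (\<lambda>i. 1 * t n i + (\<Sum>j<n. - c j * t j i))"
      by (auto simp: x_def t_def p_def poly_monom poly_sum fun_eq_iff sum_negf)
    moreover have "(\<lambda>i. \<Sum>j<n. - c j * t j i) \<in> power_space I"
      using t by (auto simp: power_space_def intro!: sum.neutral)
    ultimately have "g x = g (t n) + (\<Sum>j<n. scl (- c j) (g (t j)))"
      using g_add[of "t n"] g_sum[of "{..<n}" t "\<lambda>j. - c j"] t by simp
    then have gx: "g x \<in> W" using c by (simp add: scale_minus_left sum_negf)
    define Z where "Z = (\<Union>c\<in>{x. poly p x = 0}. {i \<in> A. f i = c})"
    have Z: "null W Z" unfolding Z_def by (rule null_UN[OF W fin fibre]) (use A in blast)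
    \<comment> \<open>Within \<open>A\<close>, \<open>x\<close> vanishes exactly on
      \<open>Z\<close>, a finite union of null fibres. Filling \<open>Z\<close> with ones gives
      support exactly \<open>A\<close> and keeps the image in \<open>W\<close>.\<close>
    define x' where "x' = (\<lambda>i. if i \<in> Z then 1 else x i)"
    have fx': "x' \<in> full A" by (auto simp: x'_def x_def Z_def full_def)
    have "g x' - g x \<in> W"
      by (rule g_cong_mod_null[OF W Z]) (use A in \<open>auto simp: x'_def x_def Z_def power_space_def\<close>)
    then have gx': "g x' \<in> W" using gx subspace_add[OF W, of "g x' - g x" "g x"] by simp
    \<comment> \<open>By the atom property, the support of \<open>u\<close> or its zero set in
      \<open>A\<close> is null. In the first case \<open>g u\<close> is in \<open>W\<close> and
      \<open>x'\<close> serves; in the second the zeros can be replaced by ones.\<close>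
    have "\<exists>u'\<in>full A. g u' - g u \<in> W" if u: "u \<in> power_space A" for u
    proof (cases "null W {i \<in> A. u i \<noteq> 0}")
      case True
      moreover have "u \<in> power_space {i \<in> A. u i \<noteq> 0}" using u by (auto simp: power_space_def)
      ultimately have "g u \<in> W" by (auto simp: null_def)
      then show ?thesis using fx' gx' subspace_diff[OF W] by blast
    next
      case False
      then have N: "null W {i \<in> A. u i = 0}"
        using atom[of "{i \<in> A. u i = 0}"] by (auto simp: set_diff_eq cong: conj_cong)
      let ?u = "\<lambda>i. if i \<in> A \<and> u i = 0 then 1 else u i"
      have "?u \<in> full A" using u by (auto simp: full_def power_space_def)
      moreover have "g ?u - g u \<in> W"
        by (rule g_cong_mod_null[OF W N]) (use A u in \<open>auto simp: power_space_def\<close>)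
      ultimately show ?thesis by blast
    qed
    then have "good W A" by (simp add: good_def)
    then show ?thesis unfolding cofinitely_good_def by (intro exI[of _ "{}"]) auto
  qed
qed

section \<open>Infinitely many disjoint blocks with equal image\<close>

definition infinitely_split :: "'v set \<Rightarrow> 'i set \<Rightarrow> bool" where
  "infinitely_split W A \<longleftrightarrow>
     (\<exists>C :: nat \<Rightarrow> 'i set. disjoint_family C \<and> (\<forall>n. C n \<subseteq> A \<and> \<not> null W (C n)))"

text \<open>A set that is not cofinitely good splits into two non-null pieces, at least one of which
  is again not cofinitely good. Keeping that piece and discarding the other gives a decreasing
  sequence whose successive differences are disjoint and non-null.\<close>

lemma infinitely_split_if_not_cofinitely_good:
  assumes W: "subspace W" and A: "A \<subseteq> I" and n: "\<not> cofinitely_good W A"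
    and below: "below_measurable_cardinals_above (UNIV :: 'k set) I"
  shows "infinitely_split W A"
proof -
  have step: "\<exists>B. B \<subseteq> X \<and> \<not> null W (X - B) \<and> \<not> cofinitely_good W B"
    if X: "X \<subseteq> A" "\<not> cofinitely_good W X" for X
  proof -
    have XI: "X \<subseteq> I" using X A by blast
    have nn: "\<not> null W X"
      using good_null[OF W _ XI] X(2) unfolding cofinitely_good_def by (metis Diff_empty empty_subsetI finite.emptyI)
    then obtain B where B: "B \<subseteq> X" "\<not> null W B" "\<not> null W (X - B)"
      using cofinitely_good_atom[OF W XI nn _ below] X(2) by blast
    have "\<not> (cofinitely_good W B \<and> cofinitely_good W (X - B))"
      using cofinitely_good_Un[OF W, of B "X - B"] X(2) XI B(1) by (auto simp: Un_absorb1)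
    moreover have "X - (X - B) = B" using B(1) by blast
    ultimately show ?thesis using B by (metis Diff_subset)
  qed
  have "\<exists>R. \<forall>n. (R n \<subseteq> A \<and> \<not> cofinitely_good W (R n)) \<and>
      (R (Suc n) \<subseteq> R n \<and> \<not> null W (R n - R (Suc n)))"
  proof (rule dependent_nat_choice)
    show "\<exists>X. X \<subseteq> A \<and> \<not> cofinitely_good W X" using n by blast
    show "\<exists>Y. (Y \<subseteq> A \<and> \<not> cofinitely_good W Y) \<and> (Y \<subseteq> X \<and> \<not> null W (X - Y))"
      if "X \<subseteq> A \<and> \<not> cofinitely_good W X" for X
      using step[of X] that by (meson order_trans)
  qed
  then obtain R where R: "\<And>n. R n \<subseteq> A" "\<And>n. R (Suc n) \<subseteq> R n" "\<And>n. \<not> null W (R n - R (Suc n))"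
    by blast
  have anti: "R m \<subseteq> R n" if "n \<le> m" for m n
    using lift_Suc_antimono_le[of R] R(2) that by blast
  have "(R m - R (Suc m)) \<inter> (R n - R (Suc n)) = {}" if "m < n" for m n
    using anti[of "Suc m" n] that by auto
  then have "disjoint_family (\<lambda>n. R n - R (Suc n))"
    unfolding disjoint_family_on_def by (metis inf_commute nat_neq_iff)
  then show ?thesis unfolding infinitely_split_def
    using R by (intro exI[of _ "\<lambda>n. R n - R (Suc n)"]) blast
qed

text \<open>Choose an infinitely split \<open>A0\<close> inside \<open>A\<close> whose image has
  least dimension modulo \<open>W\<close>. Any infinitely split subset of \<open>A0\<close> must
  then have the same image modulo \<open>W\<close>.\<close>

lemma equal_image_blocks:
  assumes W: "subspace W" and A: "infinitely_split W A"
  shows "\<exists>W' B. subspace W' \<and> W \<subset> W' \<and> disjoint_family B \<and>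
    (\<forall>n :: nat. B n \<subseteq> A \<and> span (W \<union> g ` power_space (B n)) = W')"
proof -
  define D where "D A = span (W \<union> g ` power_space A)" for A
  obtain A0 where A0: "infinitely_split W A0 \<and> A0 \<subseteq> A"
    and min: "\<And>X. infinitely_split W X \<and> X \<subseteq> A \<Longrightarrow> dim (D A0) \<le> dim (D X)"
    using ex_has_least_nat[of "\<lambda>X. infinitely_split W X \<and> X \<subseteq> A" A "\<lambda>X. dim (D X)"] A by blast
  then obtain C where C: "disjoint_family C" "\<And>n :: nat. C n \<subseteq> A0 \<and> \<not> null W (C n)"
    unfolding infinitely_split_def by blast
  \<comment> \<open>The pairing function distributes the sets \<open>C\<close> into infinitely many
    infinite groups, so that each union \<open>B n\<close> is still infinitely split.\<close>
  define B where "B n = (\<Union>m. C (prod_encode (n, m)))" for n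
  have disj: "C a \<inter> C b = {}" if "a \<noteq> b" for a b
    using C(1) that by (auto simp: disjoint_family_on_def)
  have BA: "B n \<subseteq> A0" for n using C(2) by (auto simp: B_def)
  have "infinitely_split W (B n)" for n
    unfolding infinitely_split_def
  proof (intro exI[of _ "\<lambda>m. C (prod_encode (n, m))"] conjI allI)
    show "disjoint_family (\<lambda>m. C (prod_encode (n, m)))"
      unfolding disjoint_family_on_def by (auto intro!: disj)
    show "C (prod_encode (n, m)) \<subseteq> B n" "\<not> null W (C (prod_encode (n, m)))" for m
      using C(2) by (auto simp: B_def)
  qed
  then have "dim (D A0) \<le> dim (D (B n))" for n using min[of "B n"] BA A0 by blast
  moreover have "D (B n) \<subseteq> D A0" for n
    unfolding D_def using power_space_mono[OF BA[of n]] by (intro span_mono) blast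
  ultimately have eq: "D (B n) = D A0" for n
    by (intro subspace_dim_equal) (auto simp: D_def)
  have "disjoint_family B"
    unfolding disjoint_family_on_def
  proof (intro ballI impI)
    fix m n :: nat assume "m \<noteq> n"
    then have "C (prod_encode (m, a)) \<inter> C (prod_encode (n, b)) = {}" for a b
      by (intro disj) (simp add: prod_encode_eq)
    then show "B m \<inter> B n = {}" by (auto simp: B_def)
  qed
  moreover have "W \<subseteq> D A0" by (auto simp: D_def intro: span_base)
  moreover have "W \<noteq> D A0"
  proof
    assume "W = D A0"
    moreover have "g ` power_space (C 0) \<subseteq> D A0"
      unfolding D_def using power_space_mono[of "C 0" A0] C(2) by (blast intro: span_base)
    ultimately show False using C(2)[of 0] by (simp add: null_def)
  qed
  moreover have "B n \<subseteq> A" for n using BA A0 by blast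
  ultimately show ?thesis using eq
    by (intro exI[of _ "D A0"] exI[of _ B]) (auto simp: D_def)
qed

section \<open>Full support on a finite union of blocks\<close>

lemma full_sum:
  assumes "finite M" "disjoint_family_on B M" "\<And>j. j \<in> M \<Longrightarrow> t j \<in> full (B j)" "\<And>j. j \<in> M \<Longrightarrow> c j \<noteq> 0"
  shows "(\<lambda>i. \<Sum>j\<in>M. c j * t j i) \<in> full (\<Union>j\<in>M. B j)"
  unfolding full_def
proof (intro CollectI allI)
  fix i
  show "(\<Sum>j\<in>M. c j * t j i) \<noteq> 0 \<longleftrightarrow> i \<in> (\<Union>j\<in>M. B j)"
  proof (cases "\<exists>j\<in>M. i \<in> B j")
    case True
    then obtain j where j: "j \<in> M" "i \<in> B j" by blast
    have "i \<notin> B k" if "k \<in> M" "k \<noteq> j" for k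
      using assms(2) j that by (auto simp: disjoint_family_on_def)
    then have "(\<Sum>k\<in>M - {j}. c k * t k i) = 0"
      using assms(3) by (intro sum.neutral) (auto simp: full_def)
    then have "(\<Sum>k\<in>M. c k * t k i) = c j * t j i"
      using sum.remove[OF assms(1) j(1), of "\<lambda>k. c k * t k i"] by simp
    moreover have "t j i \<noteq> 0" using assms(3)[OF j(1)] j(2) by (simp add: full_def)
    ultimately show ?thesis using j assms(4) by auto
  next
    case False
    then have "(\<Sum>k\<in>M. c k * t k i) = 0"
      using assms(3) by (intro sum.neutral) (auto simp: full_def)
    then show ?thesis using False by blast
  qed
qed

text \<open>
  Two disjoint spanning selections make every selected vector redundant, which is what allows all
  coefficients to be chosen nonzero.
\<close>

lemma full_onto_finite_union:
  assumes W: "subspace W" and W': "subspace W'"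
    and B: "disjoint_family B" and BI: "\<And>n :: nat. B n \<subseteq> I"
    and span_B: "\<And>n. span (W \<union> g ` power_space (B n)) = W'"
  shows "\<exists>M. finite M \<and> (\<forall>v\<in>W'. \<exists>u\<in>full (\<Union>j\<in>M. B j). g u - v \<in> W)"
proof -
  have sp: "W' \<subseteq> span (W \<union> g ` full (B n))" for n
  proof -
    have "g ` power_space (B n) \<subseteq> span (W \<union> g ` full (B n))"
      using image_subset_span_full[OF BI[of n]] span_mono[of "g ` full (B n)" "W \<union> g ` full (B n)"]
      by blast
    then have "span (W \<union> g ` power_space (B n)) \<subseteq> span (W \<union> g ` full (B n))"
      by (intro span_minimal) (auto intro: span_base)
    then show ?thesis using span_B by simp
  qed
  obtain M1 f1 where M1: "finite M1" "\<forall>j\<in>M1. f1 j \<in> g ` full (B j)" "W' \<subseteq> span (W \<union> f1 ` M1)"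
    using spanning_selection[of W' W "\<lambda>n. g ` full (B n)" "{}"] sp by blast
  obtain M2 f2 where M2: "finite M2" "M2 \<inter> M1 = {}" "\<forall>j\<in>M2. f2 j \<in> g ` full (B j)"
      "W' \<subseteq> span (W \<union> f2 ` M2)"
    using spanning_selection[of W' W "\<lambda>n. g ` full (B n)" M1] sp M1(1) by blast
  define M where "M = M1 \<union> M2"
  define f where "f j = (if j \<in> M1 then f1 j else f2 j)" for j
  have M: "finite M" using M1 M2 by (simp add: M_def)
  have "\<forall>j\<in>M. \<exists>t\<in>full (B j). g t = f j" using M1(2) M2(3) by (fastforce simp: M_def f_def)
  then obtain t where t: "\<And>j. j \<in> M \<Longrightarrow> t j \<in> full (B j) \<and> g (t j) = f j" by metis
  have fM1: "f ` M1 = f1 ` M1" by (auto simp: f_def)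
  have "f ` M2 = f2 ` M2" using M2(2) by (intro image_cong) (auto simp: f_def)
  then have "W' \<subseteq> span (W \<union> f ` M1)" "W' \<subseteq> span (W \<union> f ` M2)"
    using M1(3) M2(4) fM1 by simp_all
  moreover have "span (W \<union> f ` Y) \<subseteq> span (W \<union> f ` X)" if "Y \<subseteq> X" for X Y
    using that by (intro span_mono) blast
  ultimately have sub: "W' \<subseteq> span (W \<union> f ` X)" if "M1 \<subseteq> X \<or> M2 \<subseteq> X" for X
    using that by blast
  have tI: "t j \<in> power_space I" if "j \<in> M" for j
    using t[OF that] full_subset power_space_mono[OF BI[of j]] by blast
  have fW': "f j \<in> W'" if "j \<in> M" for j
  proof -
    have "f j \<in> g ` power_space (B j)" using t[OF that] full_subset[of "B j"] by force
    then show ?thesis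
      using span_B[of j] span_superset[of "W \<union> g ` power_space (B j)"] by blast
  qed
  \<comment> \<open>Deleting \<open>j\<close> leaves \<open>M1\<close> or \<open>M2\<close> intact,
    as these are disjoint, and either one already spans \<open>W'\<close> modulo
    \<open>W\<close>.\<close>
  have red: "f j \<in> span (W \<union> f ` (M - {j}))" if "j \<in> M" for j
    using sub[of "M - {j}"] fW'[OF that] M2(2) by (auto simp: M_def)
  have "\<exists>u\<in>full (\<Union>j\<in>M. B j). g u - v \<in> W" if "v \<in> W'" for v
  proof -
    have v: "v \<in> span (W \<union> f ` M)" using sub[of M] that by (auto simp: M_def)
    obtain c where c: "\<forall>j\<in>M. c j \<noteq> 0" "v - (\<Sum>j\<in>M. scl (c j) (f j)) \<in> W"
      using nonzero_coeffs[OF infinite_field M W v red] by blast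
    let ?u = "\<lambda>i. \<Sum>j\<in>M. c j * t j i"
    have "g ?u = (\<Sum>j\<in>M. scl (c j) (f j))" using g_sum[OF M, of t c] tI t by simp
    then have "g ?u - v = - (v - (\<Sum>j\<in>M. scl (c j) (f j)))" by simp
    then have "g ?u - v \<in> W" using subspace_neg[OF W c(2)] by simp
    moreover have "?u \<in> full (\<Union>j\<in>M. B j)"
      using B t c M by (intro full_sum) (auto simp: disjoint_family_on_def)
    ultimately show ?thesis by blast
  qed
  then show ?thesis using M by blast
qed

section \<open>Induction on the codimension\<close>

text \<open>The blocks in \<open>C\<close> can absorb any error lying in \<open>W'\<close>. So
  outside \<open>C\<close> it is enough to be good modulo the larger \<open>W'\<close>, which the
  induction hypothesis provides after removing a finite set \<open>S\<close>.\<close>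

lemma cofinitely_good_all:
  assumes below: "below_measurable_cardinals_above (UNIV :: 'k set) I"
    and W: "subspace W" and A: "A \<subseteq> I"
  shows "cofinitely_good W A"
  using W A
proof (induction "dim (UNIV :: 'v set) - dim W" arbitrary: W A rule: less_induct)
  case less
  note W = less.prems(1) and A = less.prems(2)
  show ?case
  proof (rule ccontr)
    assume "\<not> cofinitely_good W A"
    then obtain W' B where W': "subspace W'" "W \<subset> W'" and B: "disjoint_family B"
      and BA: "\<And>n :: nat. B n \<subseteq> A" and D: "\<And>n. span (W \<union> g ` power_space (B n)) = W'"
      using equal_image_blocks[OF W infinitely_split_if_not_cofinitely_good[OF W A _ below]] by blast
    obtain M where M: "finite M" "\<And>v. v \<in> W' \<Longrightarrow> \<exists>u\<in>full (\<Union>j\<in>M. B j). g u - v \<in> W"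
      using full_onto_finite_union[OF W W'(1) B _ D] BA A by blast
    define C where "C = (\<Union>j\<in>M. B j)"
    have CA: "C \<subseteq> A" using BA by (auto simp: C_def)
    have C: "null W' C"
      unfolding C_def
    proof (rule null_UN[OF W'(1) M(1)])
      show "null W' (B j)" for j using D[of j] span_base by (auto simp: null_def)
    qed (use BA A in blast)
    have "dim W < dim W'"
      using W W' subspace_dim_equal[of W W'] by (metis not_le psubset_eq)
    moreover have "dim W' \<le> dim (UNIV :: 'v set)" by (rule dim_subset) simp
    ultimately have "dim (UNIV :: 'v set) - dim W' < dim (UNIV :: 'v set) - dim W" by linarith
    then have "cofinitely_good W' (A - C)" using less.hyps[of W' "A - C"] W'(1) A by blast
    then obtain S where S: "finite S" "S \<subseteq> A - C" "good W' (A - C - S)"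
      unfolding cofinitely_good_def by blast
    let ?E = "A - C - S"
    have AS: "A - S = ?E \<union> C" using S(2) CA by blast
    have "\<exists>u'\<in>full (A - S). g u' - g u \<in> W" if u: "u \<in> power_space (A - S)" for u
    proof -
      let ?c = "\<lambda>i. if i \<in> C then u i else 0" and ?e = "\<lambda>i. if i \<in> C then 0 else u i"
      have "?c \<in> power_space C" "?e \<in> power_space ?E" using u by (auto simp: power_space_def)
      then obtain e where e: "e \<in> full ?E" "g e - g ?e \<in> W'" and c: "g ?c \<in> W'"
        using S(3) C unfolding good_def null_def by blast
      \<comment> \<open>This is the value \<open>w\<close> has to take on \<open>C\<close> modulo
        \<open>W\<close>: the part of \<open>g u\<close> coming from \<open>C\<close>, corrected by
        the error made outside \<open>C\<close>.\<close>
      have "g ?c - (g e - g ?e) \<in> W'" using e c subspace_diff[OF W'(1)] by blast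
      then obtain w where w: "w \<in> full C" "g w - (g ?c - (g e - g ?e)) \<in> W"
        using M(2) unfolding C_def by blast
      have "e \<in> power_space I" "w \<in> power_space I" "u \<in> power_space I"
        using e w u A CA by (auto simp: power_space_def full_def)
      then have "g (\<lambda>i. e i + w i) - g u = g w - (g ?c - (g e - g ?e))"
        using g_add[of e w] g_split[of u C] by (simp add: algebra_simps)
      moreover have "(\<lambda>i. e i + w i) \<in> full (A - S)"
        unfolding AS using full_Un[OF e(1) w(1)] by blast
      ultimately show ?thesis using w(2) by metis
    qed
    then have "cofinitely_good W A"
      unfolding cofinitely_good_def good_def using S by (intro exI[of _ S]) auto
    then show False using \<open>\<not> cofinitely_good W A\<close> by blast
  qed
qed

end

theorem corollary8:
  fixes scl :: "'k::field \<Rightarrow> 'v::ab_group_add \<Rightarrow> 'v"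
    and Basis :: "'v set"
    and I :: "'i set"
    and g :: "('i \<Rightarrow> 'k) \<Rightarrow> 'v"
  assumes "infinite (UNIV :: 'k set)"
    and "below_measurable_cardinals_above (UNIV :: 'k set) I"
    and "finite_dimensional_vector_space scl Basis"
    and "linear_on_power scl I g"
  shows "\<exists>S. finite S \<and> S \<subseteq> I \<and>
           (\<forall>v \<in> g ` power_space (I - S).
              \<exists>u \<in> power_space I. support_on I u = I - S \<and> g u = v) \<and>
           (\<exists>u \<in> power_space I. g u = 0 \<and> {i \<in> I. u i = 0} = S)"
proof -
  interpret linear_power_map scl Basis I g
    by (intro linear_power_map.intro linear_power_map_axioms.intro assms)
  \<comment> \<open>For \<open>W = {0}\<close>, congruence modulo \<open>W\<close> is
    equality.\<close>
  obtain S where S: "finite S" "S \<subseteq> I" "good {0} (I - S)"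
    using cofinitely_good_all[OF assms(2) subspace_single_0 subset_refl]
    unfolding cofinitely_good_def by blast
  have full: "\<exists>u \<in> power_space I. support_on I u = I - S \<and> g u = v"
    if v: "v \<in> g ` power_space (I - S)" for v
  proof -
    obtain u where u: "u \<in> full (I - S)" "g u = v" using S(3) v by (auto simp: good_def)
    then show ?thesis by (intro bexI[of _ u]) (auto simp: full_def power_space_def support_on_def)
  qed
  have "0 \<in> g ` power_space (I - S)"
    using g_zero by (intro image_eqI[of _ _ "\<lambda>i. 0"]) (auto simp: power_space_def)
  then obtain u where u: "u \<in> power_space I" "support_on I u = I - S" "g u = 0" using full by blast
  then have "{i \<in> I. u i = 0} = S" using S(2) by (auto simp: support_on_def)
  then show ?thesis using S full u by blast
qed

end
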